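(* Let $K$ be a finite field, let $V$ be a vector space over $K$ of odd dimension $n\geq 5$, and let $\omega$ be an alternating trilinear form on $V$. Then every subspace of $V$ of dimension $\frac{n-1}{2}$ contains a nonzero vector that lies in some two-dimensional $\omega$-singular subspace of $V$.
   Context: A two-dimensional subspace $L\subseteq V$ is $\omega$-singular if $\omega(a,b,v)=0$ for all $a,b\in L$, $v\in V$. *)

theory Defs
  imports "HOL-Analysis.Analysis"
begin

text \<open>V is modelled as K^n, i.e. the type 'k ^ 'n with CARD('n) = n.
  A trilinear form is linear in each argument separately.\<close>

definition trilinear :: "('k::field ^ 'n \<Rightarrow> 'k ^ 'n \<Rightarrow> 'k ^ 'n \<Rightarrow> 'k) \<Rightarrow> bool" where
  "trilinear w \<longleftrightarrow>
     (\<forall>b c. Vector_Spaces.linear (*s) (*) (\<lambda>a. w a b c)) \<and>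
     (\<forall>a c. Vector_Spaces.linear (*s) (*) (\<lambda>b. w a b c)) \<and>
     (\<forall>a b. Vector_Spaces.linear (*s) (*) (\<lambda>c. w a b c))"

text \<open>Alternating: vanishes whenever two of the arguments coincide.\<close>
definition alternating_trilinear :: "('k::field ^ 'n \<Rightarrow> 'k ^ 'n \<Rightarrow> 'k ^ 'n \<Rightarrow> 'k) \<Rightarrow> bool" where
  "alternating_trilinear w \<longleftrightarrow> trilinear w \<and>
     (\<forall>a b. w a a b = 0 \<and> w a b a = 0 \<and> w b a a = 0)"

definition omega_singular :: "('k::field ^ 'n \<Rightarrow> 'k ^ 'n \<Rightarrow> 'k ^ 'n \<Rightarrow> 'k) \<Rightarrow> ('k ^ 'n) set \<Rightarrow> bool" where
  "omega_singular w L \<longleftrightarrow> vec.subspace L \<and> vec.dim L = 2 \<and>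
     (\<forall>a\<in>L. \<forall>b\<in>L. \<forall>v. w a b v = 0)"

end

theory Submission
  imports Defs "HOL-Computational_Algebra.Polynomial"
begin

text \<open>
  Let \<open>n = 2m + 1\<close>, let \<open>W\<close> have dimension \<open>m\<close> with basis \<open>w\<^sub>1, \<dots>, w\<^sub>m\<close>, and split
  \<open>V = H \<oplus> K u\<close> with \<open>W \<subseteq> H\<close>, \<open>dim H = 2m\<close>, fixing a basis \<open>bs\<close> of \<open>H\<close>. For \<open>v \<in> V\<close>
  consider the pencil \<open>\<omega>(v, -, -) + t \<omega>(u, -, -)\<close> of alternating forms and its Pfaffian on
  \<open>bs\<close>, a polynomial in \<open>t\<close>. Its \<open>t\<close>-coefficient \<open>F(v)\<close> is a form of degree \<open>m - 1\<close> in the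
  coordinates of \<open>v = \<Sum> x\<^sub>i w\<^sub>i\<close>, so by Chevalley--Warning it has a zero \<open>v \<noteq> 0\<close> in \<open>W\<close>.
  On the other hand, if the radical of \<open>\<omega>(v, -, -)\<close> were just \<open>K v\<close>, then \<open>F(v) \<noteq> 0\<close>: the
  form \<open>\<omega>(v, -, -)|\<^sub>H\<close> has a second radical vector \<open>h\<close> (an odd-dimensional complement of
  \<open>K v\<close> in \<open>H\<close> carries a degenerate form), it is nondegenerate on a complement \<open>S\<close> of
  \<open>span {v, h}\<close>, and on the list \<open>v, h, s\<^sub>1, \<dots>\<close> the coefficient equals \<open>\<omega>(u, v, h) Pf(s) \<noteq> 0\<close>;
  as an alternating multilinear function of the list it is then nonzero on \<open>bs\<close> too.
  Hence some \<open>b \<notin> K v\<close> has \<open>\<omega>(v, b, -) = 0\<close>, and \<open>span {v, b}\<close> is \<open>\<omega>\<close>-singular.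
\<close>

subsection \<open>Power sums over a finite field\<close>

text \<open>The characteristic divides the number of elements: \<open>q = 0\<close> in a field with \<open>q\<close> elements.\<close>
lemma of_nat_card_eq_0: "of_nat CARD('k::{field,finite}) = (0::'k)"
proof -
  have "(\<Sum>t\<in>UNIV. t) = (\<Sum>t\<in>UNIV. t + (1::'k))"
    by (rule sum.reindex_bij_witness[of _ "\<lambda>t. t + 1" "\<lambda>t. t - 1"]) auto
  also have "\<dots> = (\<Sum>t\<in>UNIV. t) + of_nat CARD('k)"
    by (simp add: sum.distrib)
  finally show ?thesis by simp
qed

text \<open>Fermat's little theorem for a field with \<open>q\<close> elements: \<open>x\<^sup>q\<^sup>-\<^sup>1 = 1\<close> for \<open>x \<noteq> 0\<close>.\<close>
lemma finite_field_power_card_minus_1: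
  fixes x :: "'k::{field,finite}"
  assumes "x \<noteq> 0"
  shows "x ^ (CARD('k) - 1) = 1"
proof -
  let ?N = "UNIV - {0::'k}"
  have "(\<Prod>t\<in>?N. t) = (\<Prod>t\<in>?N. x * t)"
    by (rule prod.reindex_bij_witness[of _ "\<lambda>t. x * t" "\<lambda>t. t / x"]) (use assms in auto)
  also have "\<dots> = x ^ card ?N * (\<Prod>t\<in>?N. t)"
    by (simp add: prod.distrib)
  finally have "(x ^ card ?N - 1) * (\<Prod>t\<in>?N. t) = 0"
    by (simp add: algebra_simps)
  moreover have "(\<Prod>t\<in>?N. t) \<noteq> 0" by simp
  moreover have "card ?N = CARD('k) - 1" by (simp add: card_Diff_singleton)
  ultimately show ?thesis by simp
qed

text \<open>\<open>\<Sum>\<^sub>t t\<^sup>e = 0\<close> whenever \<open>e < q - 1\<close>: for \<open>e > 0\<close> some \<open>a \<noteq> 0\<close> has \<open>a\<^sup>e \<noteq> 1\<close>,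
  since \<open>x\<^sup>e = 1\<close> has at most \<open>e\<close> roots, and the sum is invariant under \<open>t \<mapsto> a t\<close>.\<close>
lemma sum_powers_eq_0:
  assumes "e < CARD('k::{field,finite}) - 1"
  shows "(\<Sum>t\<in>(UNIV::'k set). t ^ e) = 0"
proof (cases "e = 0")
  case True
  then show ?thesis using of_nat_card_eq_0[where 'k='k] by simp
next
  case False
  define p :: "'k poly" where "p = monom 1 e - 1"
  have poly_p: "poly p x = x ^ e - 1" for x
    by (simp add: p_def poly_monom)
  have "degree p \<le> e"
    unfolding p_def by (intro degree_diff_le) (auto simp: degree_monom_le)
  moreover have "p \<noteq> 0"
    using poly_p[of 0] False by (auto simp: zero_power)
  ultimately have "card {x. poly p x = 0} \<le> e"
    using card_poly_roots_bound le_trans by metis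
  then have roots: "card {x::'k. x ^ e = 1} \<le> e"
    using poly_p by simp
  have "\<not> UNIV - {0} \<subseteq> {x::'k. x ^ e = 1}"
  proof
    assume "UNIV - {0} \<subseteq> {x::'k. x ^ e = 1}"
    then have "card (UNIV - {0::'k}) \<le> card {x::'k. x ^ e = 1}"
      by (intro card_mono) auto
    then show False
      using roots assms by (simp add: card_Diff_singleton)
  qed
  then obtain a :: 'k where a: "a \<noteq> 0" "a ^ e \<noteq> 1" by blast
  have "(\<Sum>t\<in>UNIV. t ^ e) = (\<Sum>t\<in>(UNIV::'k set). (a * t) ^ e)"
    by (rule sum.reindex_bij_witness[of _ "\<lambda>t. a * t" "\<lambda>t. t / a"]) (use a in auto)
  also have "\<dots> = a ^ e * (\<Sum>t\<in>UNIV. t ^ e)"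
    by (simp add: power_mult_distrib sum_distrib_left)
  finally have "(a ^ e - 1) * (\<Sum>t\<in>(UNIV::'k set). t ^ e) = 0"
    by (simp add: algebra_simps)
  then show ?thesis using a by simp
qed

subsection \<open>Homogeneous polynomial functions and the Chevalley--Warning theorem\<close>

text \<open>Multivariate polynomials are represented by their coefficient functions on the finite
  set \<open>hexps m d\<close> of exponent vectors of total degree \<open>d\<close> in the variables \<open>0, \<dots>, m - 1\<close>;
  \<open>hom_poly m d f\<close> says that \<open>f\<close> is (the evaluation function of) a form of degree \<open>d\<close>.\<close>
definition hexps :: "nat \<Rightarrow> nat \<Rightarrow> (nat \<Rightarrow> nat) set" where
  "hexps m d = {e \<in> PiE {..<m} (\<lambda>_. {..d}). sum e {..<m} = d}"

definition hmonom :: "nat \<Rightarrow> (nat \<Rightarrow> nat) \<Rightarrow> (nat \<Rightarrow> 'a::comm_ring_1) \<Rightarrow> 'a" where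
  "hmonom m e x = (\<Prod>i<m. x i ^ e i)"

definition hom_poly :: "nat \<Rightarrow> nat \<Rightarrow> ((nat \<Rightarrow> 'a::comm_ring_1) \<Rightarrow> 'a) \<Rightarrow> bool" where
  "hom_poly m d f \<longleftrightarrow> (\<exists>c. \<forall>x. f x = (\<Sum>e\<in>hexps m d. c e * hmonom m e x))"

text \<open>There are finitely many exponent vectors; in degree \<open>0\<close> only the zero vector.\<close>
lemma finite_hexps: "finite (hexps m d)"
  unfolding hexps_def
  by (rule finite_subset[of _ "PiE {..<m} (\<lambda>_. {..d})"]) (auto intro: finite_PiE)

lemma hexps_0: "hexps m 0 = {(\<lambda>i\<in>{..<m}. 0)}"
  unfolding hexps_def by (auto simp: PiE_def extensional_def fun_eq_iff)

text \<open>Forms of a fixed degree form a module; products add degrees; linear forms and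
  coordinate functions are forms of degree \<open>1\<close>.\<close>
lemma hom_poly_zero: "hom_poly m d (\<lambda>x. 0)"
  unfolding hom_poly_def by (rule exI[of _ "\<lambda>_. 0"]) simp

lemma hom_poly_add:
  assumes "hom_poly m d f" "hom_poly m d g"
  shows "hom_poly m d (\<lambda>x. f x + g x)"
proof -
  obtain c c' where "\<And>x. f x = (\<Sum>e\<in>hexps m d. c e * hmonom m e x)"
    and "\<And>x. g x = (\<Sum>e\<in>hexps m d. c' e * hmonom m e x)"
    using assms unfolding hom_poly_def by metis
  then show ?thesis
    unfolding hom_poly_def
    by (intro exI[of _ "\<lambda>e. c e + c' e"]) (simp add: sum.distrib algebra_simps)
qed

lemma hom_poly_scale:
  assumes "hom_poly m d f"
  shows "hom_poly m d (\<lambda>x. a * f x)"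
proof -
  obtain c where "\<And>x. f x = (\<Sum>e\<in>hexps m d. c e * hmonom m e x)"
    using assms unfolding hom_poly_def by metis
  then show ?thesis
    unfolding hom_poly_def
    by (intro exI[of _ "\<lambda>e. a * c e"]) (simp add: sum_distrib_left algebra_simps)
qed

lemma hom_poly_sum:
  "finite J \<Longrightarrow> (\<And>j. j \<in> J \<Longrightarrow> hom_poly m d (f j)) \<Longrightarrow> hom_poly m d (\<lambda>x. \<Sum>j\<in>J. f j x)"
  by (induction J rule: finite_induct) (auto intro: hom_poly_add hom_poly_zero)

lemma hom_poly_const: "hom_poly m 0 (\<lambda>x. a)"
  unfolding hom_poly_def hexps_0 by (rule exI[of _ "\<lambda>_. a"]) (simp add: hmonom_def)

lemma hom_poly_var:
  assumes "i < m"
  shows "hom_poly m 1 (\<lambda>x. x i)"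
proof -
  define u where "u = (\<lambda>j\<in>{..<m}. if j = i then 1 else (0::nat))"
  have "sum u {..<m} = (\<Sum>j<m. if j = i then 1 else 0)"
    by (rule sum.cong) (auto simp: u_def)
  then have u: "u \<in> hexps m 1"
    using assms unfolding hexps_def u_def by (auto simp: PiE_def extensional_def)
  have "hmonom m u x = (\<Prod>j<m. if j = i then x j else 1)" for x :: "nat \<Rightarrow> 'a"
    unfolding hmonom_def by (rule prod.cong) (auto simp: u_def)
  then have "hmonom m u x = x i" for x :: "nat \<Rightarrow> 'a"
    using assms by simp
  moreover have "(\<Sum>e\<in>hexps m 1. (if e = u then 1 else 0) * hmonom m e x) = hmonom m u x"
    for x :: "nat \<Rightarrow> 'a"
  proof -
    have "(\<Sum>e\<in>hexps m 1. (if e = u then 1 else 0) * hmonom m e x)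
        = (\<Sum>e\<in>hexps m 1. if e = u then hmonom m e x else 0)"
      by (rule sum.cong) auto
    then show ?thesis using u finite_hexps by simp
  qed
  ultimately show ?thesis
    unfolding hom_poly_def by (intro exI[of _ "\<lambda>e. if e = u then 1 else 0"]) simp
qed

lemma hom_poly_linear: "hom_poly m 1 (\<lambda>x. \<Sum>i<m. a i * x i)"
  by (intro hom_poly_sum hom_poly_scale hom_poly_var) auto

lemma hom_poly_mult:
  assumes "hom_poly m d f" "hom_poly m d' g"
  shows "hom_poly m (d + d') (\<lambda>x. f x * g x)"
proof -
  obtain c where f: "\<And>x. f x = (\<Sum>e\<in>hexps m d. c e * hmonom m e x)"
    using assms(1) unfolding hom_poly_def by blast
  obtain c' where g: "\<And>x. g x = (\<Sum>e\<in>hexps m d'. c' e * hmonom m e x)"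
    using assms(2) unfolding hom_poly_def by blast
  let ?P = "hexps m d \<times> hexps m d'"
  \<comment> \<open>multiplying monomials adds their exponent vectors\<close>
  define h where "h = (\<lambda>p::(nat\<Rightarrow>nat)\<times>(nat\<Rightarrow>nat). (\<lambda>i\<in>{..<m}. fst p i + snd p i))"
  have h_mem: "h ` ?P \<subseteq> hexps m (d + d')"
  proof safe
    fix e e' assume e: "e \<in> hexps m d" and e': "e' \<in> hexps m d'"
    have "sum (h (e, e')) {..<m} = sum (\<lambda>i. e i + e' i) {..<m}"
      by (rule sum.cong) (auto simp: h_def)
    also have "\<dots> = d + d'" using e e' by (simp add: sum.distrib hexps_def)
    finally have "sum (h (e, e')) {..<m} = d + d'" .
    moreover have "e i \<le> d" "e' i \<le> d'" if "i < m" for i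
      using e e' that by (auto simp: hexps_def PiE_def)
    ultimately show "h (e, e') \<in> hexps m (d + d')"
      unfolding hexps_def by (auto simp: h_def PiE_def extensional_def add_mono)
  qed
  have hmonom_h: "hmonom m (h p) x = hmonom m (fst p) x * hmonom m (snd p) x"
    for p and x :: "nat \<Rightarrow> 'a"
    unfolding hmonom_def h_def by (simp add: power_add prod.distrib)
  define c'' where "c'' = (\<lambda>E. \<Sum>p\<in>{p \<in> ?P. h p = E}. c (fst p) * c' (snd p))"
  have "f x * g x = (\<Sum>E\<in>hexps m (d+d'). c'' E * hmonom m E x)" for x
  proof -
    have "f x * g x = (\<Sum>p\<in>?P. c (fst p) * hmonom m (fst p) x * (c' (snd p) * hmonom m (snd p) x))"
      by (simp add: f g sum_product sum.cartesian_product case_prod_beta)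
    also have "\<dots> = (\<Sum>p\<in>?P. c (fst p) * c' (snd p) * hmonom m (h p) x)"
      by (intro sum.cong refl) (auto simp: hmonom_h)
    also have "\<dots> = (\<Sum>E\<in>hexps m (d+d'). \<Sum>p\<in>{p \<in> ?P. h p = E}. c (fst p) * c' (snd p) * hmonom m (h p) x)"
      by (rule sum.group[symmetric]) (use finite_hexps h_mem in auto)
    also have "\<dots> = (\<Sum>E\<in>hexps m (d+d'). c'' E * hmonom m E x)"
      unfolding c''_def sum_distrib_right by (intro sum.cong refl) auto
    finally show ?thesis .
  qed
  then show ?thesis unfolding hom_poly_def by blast
qed

lemma hom_poly_power: "hom_poly m d f \<Longrightarrow> hom_poly m (d * k) (\<lambda>x. f x ^ k)"
proof (induction k)
  case 0
  then show ?case using hom_poly_const[of m 1] by simp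
next
  case (Suc k)
  then show ?case
    using hom_poly_mult[of m d f "d * k" "\<lambda>x. f x ^ k"] by (simp add: add.commute)
qed

text \<open>A form of positive degree vanishes at the origin.\<close>
lemma hom_poly_at_zero:
  assumes "hom_poly m d f" "d \<ge> 1" "\<And>i. i < m \<Longrightarrow> x i = 0"
  shows "f x = 0"
proof -
  obtain c where f: "\<And>x. f x = (\<Sum>e\<in>hexps m d. c e * hmonom m e x)"
    using assms(1) unfolding hom_poly_def by blast
  have "hmonom m e x = 0" if e: "e \<in> hexps m d" for e
  proof -
    obtain i where "i < m" "e i \<noteq> 0"
      using e assms(2) by (force simp: hexps_def)
    then show ?thesis
      unfolding hmonom_def using assms(3) by (intro prod_zero bexI[of _ i]) (auto simp: zero_power)
  qed
  then show ?thesis by (simp add: f)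
qed

text \<open>Summing a form of degree \<open>D < m (q - 1)\<close> over all of \<open>K\<^sup>m\<close> gives \<open>0\<close>: each monomial
  has some exponent below \<open>q - 1\<close>, and its sum factors into one-variable power sums.\<close>
lemma hom_poly_sum_over_space:
  fixes f :: "(nat \<Rightarrow> 'k::{field,finite}) \<Rightarrow> 'k"
  assumes "hom_poly m D f" "D < m * (CARD('k) - 1)"
  shows "(\<Sum>x\<in>PiE {..<m} (\<lambda>_. UNIV). f x) = 0"
proof -
  obtain c where f: "\<And>x. f x = (\<Sum>e\<in>hexps m D. c e * hmonom m e x)"
    using assms(1) unfolding hom_poly_def by blast
  have monom_sum: "(\<Sum>x\<in>PiE {..<m} (\<lambda>_. UNIV). hmonom m e x) = (0::'k)" if e: "e \<in> hexps m D" for e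
  proof -
    have "\<exists>i<m. e i < CARD('k) - 1"
    proof (rule ccontr)
      assume "\<not> ?thesis"
      then have "(\<Sum>_<m. CARD('k) - 1) \<le> sum e {..<m}" by (intro sum_mono) auto
      then show False using e assms(2) by (simp add: hexps_def mult.commute)
    qed
    then obtain i where i: "i < m" "e i < CARD('k) - 1" by blast
    have "(\<Sum>x\<in>PiE {..<m} (\<lambda>_. UNIV). hmonom m e x) = (\<Prod>i<m. \<Sum>t\<in>(UNIV::'k set). t ^ e i)"
      unfolding hmonom_def by (rule prod_sum_PiE[symmetric]) auto
    also have "\<dots> = 0"
      using i sum_powers_eq_0[of "e i", where 'k='k] by (intro prod_zero) auto
    finally show ?thesis .
  qed
  have "(\<Sum>x\<in>PiE {..<m} (\<lambda>_. UNIV). f x)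
      = (\<Sum>e\<in>hexps m D. c e * (\<Sum>x\<in>PiE {..<m} (\<lambda>_. UNIV). hmonom m e x))"
    unfolding f sum_distrib_left by (rule sum.swap)
  also have "\<dots> = 0" using monom_sum by simp
  finally show ?thesis .
qed

text \<open>Chevalley--Warning: a form of degree \<open>1 \<le> d < m\<close> in \<open>m\<close> variables over a finite field
  has a nontrivial zero. Otherwise \<open>1 - f\<^sup>q\<^sup>-\<^sup>1\<close> would be the indicator of the origin, whose
  sum over \<open>K\<^sup>m\<close> is \<open>1\<close>, while the sums of \<open>1\<close> and of \<open>f\<^sup>q\<^sup>-\<^sup>1\<close> both vanish.\<close>
theorem chevalley_warning:
  fixes f :: "(nat \<Rightarrow> 'k::{field,finite}) \<Rightarrow> 'k"
  assumes f: "hom_poly m d f" and "d < m" and "d \<ge> 1"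
  shows "\<exists>x\<in>PiE {..<m} (\<lambda>_. UNIV). (\<exists>i<m. x i \<noteq> 0) \<and> f x = 0"
proof (rule ccontr)
  assume no_zero: "\<not> ?thesis"
  let ?C = "PiE {..<m} (\<lambda>_. UNIV::'k set)"
  let ?q = "CARD('k)"
  have "card {0::'k, 1} \<le> ?q" by (intro card_mono) auto
  then have q2: "?q \<ge> 2" by simp
  define x0 where "x0 = (\<lambda>i\<in>{..<m}. 0::'k)"
  have "x0 \<in> ?C" by (simp add: x0_def)
  moreover have "f x0 = 0" by (rule hom_poly_at_zero[OF f \<open>d \<ge> 1\<close>]) (simp add: x0_def)
  ultimately have zeros: "{x\<in>?C. f x = 0} = {x0}"
  proof safe
    fix x assume x: "x \<in> ?C" "f x = 0"
    then have "\<forall>i<m. x i = 0" using no_zero by blast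
    then show "x = x0" using x unfolding x0_def by (auto simp: PiE_def extensional_def fun_eq_iff)
  qed
  have "(\<Sum>x\<in>?C. 1 - f x ^ (?q - 1)) = (\<Sum>x\<in>?C. if f x = 0 then 1 else (0::'k))"
    using finite_field_power_card_minus_1 q2 by (intro sum.cong) (auto simp: zero_power)
  also have "\<dots> = (\<Sum>x\<in>{x\<in>?C. f x = 0}. 1)"
    by (rule sum.inter_filter[symmetric]) (auto intro: finite_PiE)
  also have "\<dots> = 1" using zeros by simp
  finally have one: "(\<Sum>x\<in>?C. 1 - f x ^ (?q - 1)) = 1" .
  have "(\<Sum>x\<in>?C. (1::'k)) = of_nat (?q ^ m)" by (simp add: card_PiE)
  also have "\<dots> = 0" using \<open>d < m\<close> of_nat_card_eq_0[where 'k='k] by simp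
  finally have "(\<Sum>x\<in>?C. (1::'k)) = 0" .
  moreover have "(\<Sum>x\<in>?C. f x ^ (?q - 1)) = 0"
    using hom_poly_power[OF f] \<open>d < m\<close> q2 by (intro hom_poly_sum_over_space) auto
  ultimately have "(\<Sum>x\<in>?C. 1 - f x ^ (?q - 1)) = 0" by (simp add: sum_subtractf)
  then show False using one by simp
qed

subsection \<open>Pfaffians by Laplace expansion\<close>

text \<open>\<open>remove_nth j xs\<close> deletes the \<open>j\<close>-th entry of a list.\<close>
definition remove_nth :: "nat \<Rightarrow> 'a list \<Rightarrow> 'a list" where
  "remove_nth j xs = take j xs @ drop (Suc j) xs"

lemma length_remove_nth [simp]: "j < length xs \<Longrightarrow> length (remove_nth j xs) = length xs - 1"
  by (simp add: remove_nth_def)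

lemma nth_remove_nth:
  "j < length xs \<Longrightarrow> k < length xs - 1 \<Longrightarrow> remove_nth j xs ! k = xs ! (if k < j then k else Suc k)"
  by (auto simp: remove_nth_def nth_append min_def)

lemma remove_nth_Cons_0 [simp]: "remove_nth 0 (y # ys) = ys"
  by (simp add: remove_nth_def)

lemma remove_nth_Cons_Suc [simp]: "remove_nth (Suc j) (y # ys) = y # remove_nth j ys"
  by (simp add: remove_nth_def)

lemma remove_nth_remove_nth:
  "j \<le> k \<Longrightarrow> Suc k < length xs \<Longrightarrow> remove_nth k (remove_nth j xs) = remove_nth j (remove_nth (Suc k) xs)"
  by (intro nth_equalityI) (auto simp: nth_remove_nth)

lemma remove_nth_adjacent_eq:
  "Suc i < length xs \<Longrightarrow> xs ! i = xs ! Suc i \<Longrightarrow> remove_nth i xs = remove_nth (Suc i) xs"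
  by (intro nth_equalityI) (auto simp: nth_remove_nth nat_less_le)

lemma set_remove_nth: "set (remove_nth j xs) \<subseteq> set xs"
  unfolding remove_nth_def by (auto dest: in_set_takeD in_set_dropD)

lemma remove_nth_update_same: "remove_nth j (xs[j := x]) = remove_nth j xs"
  by (intro nth_equalityI) (auto simp: remove_nth_def nth_append)

lemma remove_nth_update:
  "j < length xs \<Longrightarrow> i < length xs \<Longrightarrow> i \<noteq> j \<Longrightarrow>
   remove_nth j (xs[i := x]) = (remove_nth j xs)[(if i < j then i else i - 1) := x]"
  by (intro nth_equalityI) (auto simp: nth_remove_nth nth_list_update)

text \<open>The Pfaffian of the Gram matrix \<open>(\<beta> y\<^sub>i y\<^sub>j)\<close> of a list of vectors, defined by expansion
  along the first entry; for an alternating form \<open>\<beta>\<close> it is an alternating multilinear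
  function of the list (shown below).\<close>
fun pfaffian :: "('v \<Rightarrow> 'v \<Rightarrow> 'r::comm_ring_1) \<Rightarrow> 'v list \<Rightarrow> 'r" where
  "pfaffian \<beta> [] = 1"
| "pfaffian \<beta> (y # ys) =
     (\<Sum>j<length ys. (-1)^j * \<beta> y (ys!j) * pfaffian \<beta> (remove_nth j ys))"

text \<open>Exchanging the order of summation over \<open>j < k < L\<close>.\<close>
lemma sum_upper_triangle_swap:
  "(\<Sum>j<L. \<Sum>k\<in>{Suc j..<L}. G j k) = (\<Sum>k<L. \<Sum>j<k. G j k :: 'a::comm_monoid_add)"
proof (induction L)
  case (Suc L)
  have "(\<Sum>j<Suc L. \<Sum>k\<in>{Suc j..<Suc L}. G j k) = (\<Sum>j<L. \<Sum>k\<in>{Suc j..<Suc L}. G j k)"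
    by simp
  also have "\<dots> = (\<Sum>j<L. (\<Sum>k\<in>{Suc j..<L}. G j k) + G j L)"
    by (intro sum.cong refl) (simp add: atLeastLessThanSuc, rule add.commute)
  also have "\<dots> = (\<Sum>k<Suc L. \<Sum>j<k. G j k)"
    using Suc by (simp add: sum.distrib)
  finally show ?case .
qed simp

text \<open>Expanding a Pfaffian after deleting the \<open>j\<close>-th entry, indexed by the original
  positions \<open>k < j\<close> and \<open>k > j\<close> of the entries of \<open>ys\<close>.\<close>
lemma pfaffian_Cons_remove_nth:
  fixes \<beta> :: "'v \<Rightarrow> 'v \<Rightarrow> 'r::comm_ring_1"
  assumes j: "j < length ys"
  shows "pfaffian \<beta> (b # remove_nth j ys)
    = (\<Sum>k<j. (-1)^k * \<beta> b (ys!k) * pfaffian \<beta> (remove_nth k (remove_nth j ys)))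
      + (\<Sum>k\<in>{Suc j..<length ys}. (-1)^(k - 1) * \<beta> b (ys!k) * pfaffian \<beta> (remove_nth j (remove_nth k ys)))"
proof -
  let ?L = "length ys"
  let ?t = "\<lambda>k. (-1)^k * \<beta> b (remove_nth j ys ! k) * pfaffian \<beta> (remove_nth k (remove_nth j ys))"
  have split: "{..<?L - 1} = {..<j} \<union> {j..<?L - 1}" using j by auto
  have "pfaffian \<beta> (b # remove_nth j ys) = (\<Sum>k<j. ?t k) + (\<Sum>k\<in>{j..<?L - 1}. ?t k)"
    unfolding pfaffian.simps length_remove_nth[OF j] split
    by (rule sum.union_disjoint) auto
  also have "(\<Sum>k<j. ?t k) = (\<Sum>k<j. (-1)^k * \<beta> b (ys!k) * pfaffian \<beta> (remove_nth k (remove_nth j ys)))"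
    using j by (intro sum.cong refl) (simp add: nth_remove_nth)
  also have "(\<Sum>k\<in>{j..<?L - 1}. ?t k)
      = (\<Sum>k\<in>{j..<?L - 1}. (-1)^k * \<beta> b (ys ! Suc k) * pfaffian \<beta> (remove_nth j (remove_nth (Suc k) ys)))"
    using j by (intro sum.cong refl) (simp add: nth_remove_nth, subst remove_nth_remove_nth, auto)
  also have "\<dots> = (\<Sum>k\<in>{Suc j..<Suc (?L - 1)}.
      (-1)^(k - 1) * \<beta> b (ys ! k) * pfaffian \<beta> (remove_nth j (remove_nth k ys)))"
    by (subst sum.shift_bounds_Suc_ivl) simp
  also have "Suc (?L - 1) = ?L" using j by simp
  finally show ?thesis .
qed

text \<open>Expansion along the first two entries; its use is that the Pfaffian vanishes when
  the first two entries coincide.\<close>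
lemma pfaffian_Cons_Cons:
  fixes \<beta> :: "'v \<Rightarrow> 'v \<Rightarrow> 'r::comm_ring_1"
  shows "pfaffian \<beta> (a # b # ys) = \<beta> a b * pfaffian \<beta> ys +
     (\<Sum>j<length ys. \<Sum>k<j. (-1)^(j+k) * (\<beta> a (ys!k) * \<beta> b (ys!j) - \<beta> a (ys!j) * \<beta> b (ys!k))
        * pfaffian \<beta> (remove_nth k (remove_nth j ys)))"
proof -
  let ?L = "length ys"
  let ?D = "\<lambda>k j. pfaffian \<beta> (remove_nth k (remove_nth j ys))"
  note inner = pfaffian_Cons_remove_nth[of _ ys \<beta> b]
  have "pfaffian \<beta> (a # b # ys)
      = \<beta> a b * pfaffian \<beta> ys + (\<Sum>j<?L. (-1)^(Suc j) * \<beta> a (ys!j) * pfaffian \<beta> (b # remove_nth j ys))"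
    by (simp only: pfaffian.simps length_Cons sum.lessThan_Suc_shift) simp
  also have "(\<Sum>j<?L. (-1)^(Suc j) * \<beta> a (ys!j) * pfaffian \<beta> (b # remove_nth j ys))
     = (\<Sum>j<?L. \<Sum>k<j. (-1)^(Suc j) * \<beta> a (ys!j) * ((-1)^k * \<beta> b (ys!k) * ?D k j))
       + (\<Sum>j<?L. \<Sum>k\<in>{Suc j..<?L}. (-1)^(Suc j) * \<beta> a (ys!j) * ((-1)^(k - 1) * \<beta> b (ys!k) * ?D j k))"
    by (simp add: inner sum.distrib sum_distrib_left distrib_left del: pfaffian.simps)
  also have "(\<Sum>j<?L. \<Sum>k\<in>{Suc j..<?L}. (-1)^(Suc j) * \<beta> a (ys!j) * ((-1)^(k - 1) * \<beta> b (ys!k) * ?D j k))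
     = (\<Sum>k<?L. \<Sum>j<k. (-1)^(Suc j) * \<beta> a (ys!j) * ((-1)^(k - 1) * \<beta> b (ys!k) * ?D j k))"
    by (rule sum_upper_triangle_swap)
  also have "\<dots> = (\<Sum>j<?L. \<Sum>k<j. (-1)^(j+k) * (\<beta> a (ys!k) * \<beta> b (ys!j)) * ?D k j)"
  proof (intro sum.cong refl)
    fix j k assume "j \<in> {..<?L}" "k \<in> {..<j}"
    then have "Suc k + (j - 1) = j + k" by simp
    then have sign: "(-1::'r)^(Suc k) * (-1)^(j - 1) = (-1)^(j+k)" by (metis power_add)
    have "(-1)^(Suc k) * \<beta> a (ys!k) * ((-1)^(j - 1) * \<beta> b (ys!j) * ?D k j)
        = ((-1::'r)^(Suc k) * (-1)^(j - 1)) * (\<beta> a (ys!k) * \<beta> b (ys!j)) * ?D k j"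
      by (simp only: mult_ac)
    then show "(-1)^(Suc k) * \<beta> a (ys!k) * ((-1)^(j - 1) * \<beta> b (ys!j) * ?D k j)
             = (-1)^(j+k) * (\<beta> a (ys!k) * \<beta> b (ys!j)) * ?D k j"
      by (simp only: sign)
  qed
  also have "(\<Sum>j<?L. \<Sum>k<j. (-1)^(Suc j) * \<beta> a (ys!j) * ((-1)^k * \<beta> b (ys!k) * ?D k j))
      = (\<Sum>j<?L. \<Sum>k<j. - ((-1)^(j+k) * (\<beta> a (ys!j) * \<beta> b (ys!k)) * ?D k j))"
    by (intro sum.cong refl) (simp add: power_add algebra_simps)
  also have "(\<Sum>j<?L. \<Sum>k<j. - ((-1)^(j+k) * (\<beta> a (ys!j) * \<beta> b (ys!k)) * ?D k j))
      + (\<Sum>j<?L. \<Sum>k<j. (-1)^(j+k) * (\<beta> a (ys!k) * \<beta> b (ys!j)) * ?D k j)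
      = (\<Sum>j<?L. \<Sum>k<j. (-1)^(j+k) * (\<beta> a (ys!k) * \<beta> b (ys!j) - \<beta> a (ys!j) * \<beta> b (ys!k)) * ?D k j)"
    by (simp only: sum.distrib[symmetric]) (intro sum.cong refl, simp add: algebra_simps)
  finally show ?thesis
    by (simp only: add.assoc)
qed

text \<open>Bilinear alternating forms on \<open>K\<^sup>n\<close> with values in a commutative ring \<open>R\<close> that is a
  \<open>K\<close>-algebra via \<open>emb\<close>; besides \<open>R = K\<close> we need \<open>R = K[t]\<close> for pencils of forms.\<close>
locale alt_bilinear =
  fixes \<beta> :: "'k::field ^ 'n \<Rightarrow> 'k ^ 'n \<Rightarrow> 'r::comm_ring_1" and emb :: "'k \<Rightarrow> 'r"
  assumes add_left: "\<beta> (a + b) c = \<beta> a c + \<beta> b c"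
    and add_right: "\<beta> c (a + b) = \<beta> c a + \<beta> c b"
    and scale_left: "\<beta> (t *s a) c = emb t * \<beta> a c"
    and scale_right: "\<beta> c (t *s a) = emb t * \<beta> c a"
    and alternating: "\<beta> a a = 0"
begin

text \<open>The Pfaffian is linear in each entry, by induction on the length via the expansion.\<close>
lemma pfaffian_linear:
  assumes "i < length zs"
  shows "pfaffian \<beta> (zs[i := x + y]) = pfaffian \<beta> (zs[i := x]) + pfaffian \<beta> (zs[i := y])
    \<and> pfaffian \<beta> (zs[i := t *s x]) = emb t * pfaffian \<beta> (zs[i := x])"
  using assms
proof (induction "length zs" arbitrary: zs i x y t rule: less_induct)
  case less
  obtain z ys where zs: "zs = z # ys" using less.prems by (cases zs) auto
  show ?case
  proof (cases i)
    case 0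
    show ?thesis unfolding zs 0
      by (simp add: add_left scale_left sum.distrib sum_distrib_left algebra_simps)
  next
    case (Suc i')
    have i': "i' < length ys" using less.prems zs Suc by simp
    let ?T = "\<lambda>j x. (-1)^j * \<beta> z (ys[i' := x] ! j) * pfaffian \<beta> (remove_nth j (ys[i' := x]))"
    have T: "?T j (x + y) = ?T j x + ?T j y \<and> ?T j (t *s x) = emb t * ?T j x"
      if j: "j < length ys" for j
    proof (cases "j = i'")
      case True
      then show ?thesis
        using i' by (simp add: remove_nth_update_same add_right scale_right algebra_simps)
    next
      case False
      let ?i = "if i' < j then i' else i' - 1"
      have upd: "remove_nth j (ys[i' := w]) = (remove_nth j ys)[?i := w]" for w
        using False by (intro remove_nth_update j i') auto
      have "?i < length (remove_nth j ys)" "length (remove_nth j ys) < length zs"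
        using j i' False zs by auto
      then show ?thesis
        using False less.hyps[of "remove_nth j ys" ?i x y t] by (simp add: upd algebra_simps)
    qed
    have expand: "pfaffian \<beta> (zs[i := w]) = (\<Sum>j<length ys. ?T j w)" for w
      by (simp add: zs Suc)
    show ?thesis
      unfolding expand using T by (simp add: sum.distrib sum_distrib_left)
  qed
qed

text \<open>The Pfaffian vanishes when two adjacent entries coincide.\<close>
lemma pfaffian_adjacent_eq:
  assumes "Suc i < length zs" "zs ! i = zs ! Suc i"
  shows "pfaffian \<beta> zs = 0"
  using assms
proof (induction "length zs" arbitrary: zs i rule: less_induct)
  case less
  obtain z ys where zs: "zs = z # ys" using less.prems by (cases zs) auto
  show ?case
  proof (cases i)
    case 0
    then obtain ys' where ys: "ys = z # ys'" using less.prems zs by (cases ys) auto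
    show ?thesis unfolding zs ys pfaffian_Cons_Cons by (simp add: alternating mult.commute)
  next
    case (Suc i')
    have i': "Suc i' < length ys" and eq: "ys ! i' = ys ! Suc i'"
      using less.prems zs Suc by auto
    let ?T = "\<lambda>j. (-1)^j * \<beta> z (ys ! j) * pfaffian \<beta> (remove_nth j ys)"
    \<comment> \<open>removing any other entry keeps two equal adjacent entries\<close>
    have other: "?T j = 0" if j: "j \<in> {..<length ys} - {i', Suc i'}" for j
    proof -
      let ?i = "if j < i' then i' - 1 else i'"
      have "Suc ?i < length (remove_nth j ys)" "remove_nth j ys ! ?i = remove_nth j ys ! Suc ?i"
        "length (remove_nth j ys) < length zs"
        using j i' eq zs by (auto simp: nth_remove_nth)
      then show ?thesis using less.hyps by fastforce
    qed
    have "pfaffian \<beta> zs = (\<Sum>j<length ys. ?T j)" by (simp add: zs)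
    also have "\<dots> = (\<Sum>j\<in>{i', Suc i'}. ?T j)"
      by (rule sum.mono_neutral_right) (use i' other in auto)
    also have "\<dots> = 0" using remove_nth_adjacent_eq[OF i' eq] eq by simp
    finally show ?thesis .
  qed
qed

end

subsection \<open>Alternating multilinear functions of lists of vectors\<close>

text \<open>A function of lists of \<open>N\<close> vectors that is linear in each entry and vanishes
  when two adjacent entries coincide.\<close>
locale alt_multilinear =
  fixes N :: nat and \<Phi> :: "('k::field ^ 'n) list \<Rightarrow> 'k"
  assumes add: "length zs = N \<Longrightarrow> i < N \<Longrightarrow> \<Phi> (zs[i := x + y]) = \<Phi> (zs[i := x]) + \<Phi> (zs[i := y])"
    and scale: "length zs = N \<Longrightarrow> i < N \<Longrightarrow> \<Phi> (zs[i := t *s x]) = t * \<Phi> (zs[i := x])"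
    and adjacent_eq: "length zs = N \<Longrightarrow> Suc i < N \<Longrightarrow> zs ! i = zs ! Suc i \<Longrightarrow> \<Phi> zs = 0"

text \<open>Composing the Pfaffian of an alternating form with a \<open>K\<close>-linear map \<open>R \<rightarrow> K\<close>
  gives an alternating multilinear function.\<close>
lemma (in alt_bilinear) alt_multilinear_pfaffian:
  assumes "\<And>t r. \<phi> (emb t * r) = t * \<phi> r" and "\<And>r s. \<phi> (r + s) = \<phi> r + \<phi> s"
  shows "alt_multilinear N (\<lambda>zs. \<phi> (pfaffian \<beta> zs))"
proof -
  have "\<phi> 0 = 0" using assms(2)[of 0 0] by (metis add_cancel_right_right)
  then show ?thesis
    by unfold_locales (use pfaffian_linear pfaffian_adjacent_eq assms in auto)
qed

text \<open>Additivity in two entries forces antisymmetry once the diagonal vanishes.\<close>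
lemma antisymmetric_if_alternating:
  fixes f :: "'a::ab_group_add \<Rightarrow> 'a \<Rightarrow> 'b::ab_group_add"
  assumes "\<And>a b c. f (a + b) c = f a c + f b c" "\<And>a b c. f c (a + b) = f c a + f c b"
    and "\<And>c. f c c = 0"
  shows "f a b = - f b a"
proof -
  have "0 = f (a + b) (a + b)" using assms(3) by simp
  also have "\<dots> = f a a + f a b + f b a + f b b" by (simp add: assms(1,2))
  finally show ?thesis using assms(3) by (simp add: eq_neg_iff_add_eq_0 add.commute)
qed

context alt_multilinear
begin

text \<open>\<open>\<Phi>\<close> is antisymmetric in two entries \<open>i \<noteq> j\<close> on which it is alternating.\<close>
lemma antisymmetric_pair:
  assumes zs: "length zs = N" and ij: "i < N" "j < N" "i \<noteq> j"
    and diag: "\<And>c. \<Phi> (zs[i := c, j := c]) = 0"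
  shows "\<Phi> (zs[i := a, j := b]) = - \<Phi> (zs[i := b, j := a])"
proof (rule antisymmetric_if_alternating[of "\<lambda>a b. \<Phi> (zs[i := a, j := b])", OF _ _ diag])
  fix a b c
  have "zs[i := w, j := c] = (zs[j := c])[i := w]" for w using ij by (simp add: list_update_swap)
  then show "\<Phi> (zs[i := a + b, j := c]) = \<Phi> (zs[i := a, j := c]) + \<Phi> (zs[i := b, j := c])"
    using add[of "zs[j := c]" i a b] zs ij by simp
  show "\<Phi> (zs[i := c, j := a + b]) = \<Phi> (zs[i := c, j := a]) + \<Phi> (zs[i := c, j := b])"
    using add[of "zs[i := c]" j a b] zs ij by simp
qed

text \<open>\<open>\<Phi>\<close> vanishes when any two entries coincide: move them together by adjacent swaps.\<close>
lemma repeated_entry: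
  assumes "length zs = N" "i < j" "j < N" "zs ! i = zs ! j"
  shows "\<Phi> zs = 0"
proof -
  obtain d where j: "j = Suc (i + d)" using assms(2) less_iff_Suc_add by auto
  show ?thesis using assms(1,3,4) unfolding j
  proof (induction d arbitrary: zs)
    case 0
    then show ?case using adjacent_eq by simp
  next
    case (Suc d)
    let ?j' = "Suc (i + d)" and ?j = "Suc (i + Suc d)"
    define zs' where "zs' = zs[?j' := zs ! ?j, ?j := zs ! ?j']"
    have "length zs' = N" "zs' ! i = zs' ! ?j'"
      using Suc.prems by (simp_all add: zs'_def nth_list_update)
    then have "\<Phi> zs' = 0" using Suc.IH Suc.prems by simp
    moreover have "\<Phi> (zs[?j' := c, ?j := c]) = 0" for c
      by (rule adjacent_eq[of _ ?j']) (use Suc.prems in auto)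
    then have "\<Phi> (zs[?j' := zs ! ?j', ?j := zs ! ?j]) = - \<Phi> zs'"
      unfolding zs'_def by (intro antisymmetric_pair) (use Suc.prems in auto)
    ultimately show ?case by simp
  qed
qed

text \<open>Swapping two entries changes the sign.\<close>
lemma swap:
  assumes "length zs = N" "i < N" "j < N" "i \<noteq> j"
  shows "\<Phi> (zs[i := zs ! j, j := zs ! i]) = - \<Phi> zs"
proof -
  have "\<Phi> (zs[i := c, j := c]) = 0" for c
    using assms repeated_entry[of "zs[i := c, j := c]" i j] repeated_entry[of "zs[i := c, j := c]" j i]
    by (cases "i < j") auto
  then have "\<Phi> (zs[i := zs ! i, j := zs ! j]) = - \<Phi> (zs[i := zs ! j, j := zs ! i])"
    by (intro antisymmetric_pair) (use assms in auto)
  then show ?thesis by simp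
qed

text \<open>Linearity in one entry, for a finite linear combination.\<close>
lemma sum_entry:
  assumes "finite V" "length zs = N" "i < N"
  shows "\<Phi> (zs[i := (\<Sum>v\<in>V. c v *s v)]) = (\<Sum>v\<in>V. c v * \<Phi> (zs[i := v]))"
  using assms(1)
proof (induction V rule: finite_induct)
  case empty
  have "\<Phi> (zs[i := 0 *s 0]) = 0 * \<Phi> (zs[i := 0])" by (rule scale) (use assms in auto)
  then show ?case by simp
next
  case (insert v V)
  then show ?case using add[OF assms(2,3)] scale[OF assms(2,3)] by simp
qed

text \<open>If \<open>\<Phi>\<close> vanishes on a list \<open>b\<close> of distinct vectors, it vanishes on every rearrangement
  of \<open>b\<close>; induction on the number of misplaced entries, fixing one by a swap.\<close>
lemma vanishes_on_rearrangement:
  assumes b: "length b = N" "distinct b" "\<Phi> b = 0"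
  shows "length zs = N \<Longrightarrow> distinct zs \<Longrightarrow> set zs = set b \<Longrightarrow> \<Phi> zs = 0"
proof (induction "card {i. i < N \<and> zs ! i \<noteq> b ! i}" arbitrary: zs rule: less_induct)
  case less
  let ?wrong = "\<lambda>zs. {k. k < N \<and> zs ! k \<noteq> b ! k}"
  show ?case
  proof (cases "?wrong zs = {}")
    case True
    then have "zs = b" using less.prems b by (intro nth_equalityI) auto
    then show ?thesis using b by simp
  next
    case False
    then obtain i where i: "i < N" "zs ! i \<noteq> b ! i" by blast
    have "b ! i \<in> set zs" using less.prems b i by simp
    then obtain j where j: "j < N" "zs ! j = b ! i"
      using less.prems by (metis in_set_conv_nth)
    have ij: "i \<noteq> j" using i j by auto
    define zs' where "zs' = zs[i := zs ! j, j := zs ! i]"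
    have zs': "length zs' = N" "distinct zs'" "set zs' = set b"
      unfolding zs'_def using less.prems i(1) j(1) by simp_all
    have "?wrong zs' \<subseteq> ?wrong zs"
    proof safe
      fix k assume k: "k < N" "zs' ! k \<noteq> b ! k" "zs ! k = b ! k"
      have "k \<noteq> j" using k j b i ij by (auto simp: nth_eq_iff_index_eq)
      moreover have "k \<noteq> i" using k i by auto
      ultimately show False using k by (simp add: zs'_def)
    qed
    moreover have "i \<in> ?wrong zs - ?wrong zs'"
      using i j ij less.prems by (simp add: zs'_def nth_list_update)
    ultimately have "card (?wrong zs') < card (?wrong zs)"
      by (intro psubset_card_mono) auto
    then have "\<Phi> zs' = 0" using less.hyps zs' by blast
    moreover have "\<Phi> zs' = - \<Phi> zs" unfolding zs'_def by (rule swap) (use less.prems i j ij in auto)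
    ultimately show ?thesis by simp
  qed
qed

text \<open>If \<open>\<Phi>\<close> vanishes on a list \<open>b\<close> of \<open>N\<close> distinct vectors, it vanishes on all lists of
  vectors in the span of \<open>b\<close>: expand the entries one at a time; the lists of elements of
  \<open>b\<close> that arise either repeat an entry or rearrange \<open>b\<close>.\<close>
lemma vanishes_on_span:
  assumes b: "length b = N" "distinct b" "\<Phi> b = 0"
    and zs: "length zs = N" "set zs \<subseteq> vec.span (set b)"
  shows "\<Phi> zs = 0"
proof -
  have expand: "\<Phi> zs = 0"
    if "k \<le> N" "length zs = N" "\<forall>i<k. zs ! i \<in> vec.span (set b)"
      "\<forall>i. k \<le> i \<longrightarrow> i < N \<longrightarrow> zs ! i \<in> set b" for k zs
    using that
  proof (induction k arbitrary: zs)
    case 0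
    then have sub: "set zs \<subseteq> set b" by (auto simp: in_set_conv_nth)
    show ?case
    proof (cases "distinct zs")
      case True
      then have "set zs = set b"
        using sub b 0 by (intro card_subset_eq) (auto simp: distinct_card)
      then show ?thesis using vanishes_on_rearrangement[OF b] 0 True by blast
    next
      case False
      then obtain i j where "i < N" "j < N" "i \<noteq> j" "zs ! i = zs ! j"
        using 0 by (auto simp: distinct_conv_nth)
      then show ?thesis
        using repeated_entry[of zs i j] repeated_entry[of zs j i] 0 by (cases "i < j") auto
    qed
  next
    case (Suc k)
    have k: "k < N" using Suc.prems by simp
    obtain c where c: "zs ! k = (\<Sum>v\<in>set b. c v *s v)"
      using Suc.prems by (auto simp: vec.span_finite)
    have "\<Phi> zs = \<Phi> (zs[k := (\<Sum>v\<in>set b. c v *s v)])" by (metis c list_update_id)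
    also have "\<dots> = (\<Sum>v\<in>set b. c v * \<Phi> (zs[k := v]))"
      using sum_entry Suc.prems k by simp
    also have "\<dots> = 0"
      using Suc.IH Suc.prems k by (intro sum.neutral ballI) (auto simp: nth_list_update)
    finally show ?case .
  qed
  show ?thesis by (rule expand[of N]) (use zs in auto)
qed

end

subsection \<open>Direct sums and complements\<close>

text \<open>Dimension of an internal direct sum.\<close>
lemma dim_direct_sum:
  fixes P Q :: "('k::field ^ 'n) set"
  assumes "vec.subspace P" "vec.subspace Q" "P \<inter> Q \<subseteq> {0}"
  shows "vec.dim {x + y |x y. x \<in> P \<and> y \<in> Q} = vec.dim P + vec.dim Q"
proof -
  have "vec.dim (P \<inter> Q) = 0" using assms(3) by simp
  then show ?thesis using vec.dim_sums_Int[OF assms(1,2)] by linarith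
qed

text \<open>Extending \<open>A \<union> C\<close> to a basis of \<open>H\<close> and spanning the basis vectors outside \<open>A\<close>
  gives a complement of \<open>span A\<close> in \<open>H\<close> that contains \<open>C\<close>.\<close>
lemma complement_subspace:
  fixes H :: "('k::field ^ 'n) set"
  assumes H: "vec.subspace H" and indep: "vec.independent (A \<union> C)"
    and sub: "A \<union> C \<subseteq> H" and disj: "A \<inter> C = {}"
  obtains S where "vec.subspace S" "C \<subseteq> S" "S \<subseteq> H" "vec.dim S + card A = vec.dim H"
    "vec.span A \<inter> S \<subseteq> {0}" "\<And>y. y \<in> H \<Longrightarrow> \<exists>a\<in>vec.span A. y - a \<in> S"
proof -
  obtain B where B: "A \<union> C \<subseteq> B" "B \<subseteq> H" "vec.independent B" "H \<subseteq> vec.span B"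
    using vec.maximal_independent_subset_extend[OF sub indep] by blast
  have "finite B" using B(3) by (rule vec.finiteI_independent)
  then have fin: "finite A" "finite (B - A)" using B(1) finite_subset by auto
  define S where "S = vec.span (B - A)"
  have dims: "vec.dim (vec.span A) = card A" "vec.dim S = card (B - A)" "vec.dim H = card B"
    using B vec.independent_mono[OF B(3)]
    by (auto simp: S_def vec.dim_eq_card_independent vec.basis_card_eq_dim)
  have sums: "vec.span B = {x + y |x y. x \<in> vec.span A \<and> y \<in> S}"
    using B(1) unfolding S_def vec.span_Un[symmetric] by (metis Un_Diff_cancel le_supE sup.absorb2)
  have "vec.dim (vec.span B) = card B"
    using B(3) by (rule vec.dim_span_eq_card_independent)
  moreover have "card (B - A) = card B - card A" "card A \<le> card B"
    using \<open>finite B\<close> fin(1) B(1) by (auto simp: card_Diff_subset card_mono)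
  ultimately have "vec.dim (vec.span A \<inter> S) = 0"
    using vec.dim_sums_Int[of "vec.span A" S] dims sums by (simp add: S_def)
  then have "vec.span A \<inter> S \<subseteq> {0}" by (rule vec.dim_eq_0[THEN iffD1])
  moreover have "\<exists>a\<in>vec.span A. y - a \<in> S" if "y \<in> H" for y
    using that B(4) unfolding sums by (force simp: algebra_simps)
  moreover have "S \<subseteq> H" unfolding S_def using B(2) H by (intro vec.span_minimal) auto
  moreover have "C \<subseteq> S" unfolding S_def using B(1) disj by (auto intro: vec.span_base)
  moreover have "vec.dim S + card A = vec.dim H"
    using dims B(1) fin \<open>finite B\<close> by (simp add: card_Diff_subset card_mono)
  moreover have "vec.subspace S" by (simp add: S_def)
  ultimately show ?thesis using that by simp
qed

subsection \<open>Alternating bilinear forms\<close>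

context alt_bilinear
begin

lemma skew: "\<beta> a b = - \<beta> b a"
  by (rule antisymmetric_if_alternating[of \<beta>]) (auto simp: add_left add_right alternating)

lemma zero_right [simp]: "\<beta> c 0 = 0"
  using add_right[of c 0 0] by simp

end

text \<open>Scalar-valued alternating forms.\<close>
locale alt_form = alt_bilinear \<beta> "id :: 'k \<Rightarrow> 'k"
  for \<beta> :: "'k::field ^ 'n \<Rightarrow> 'k ^ 'n \<Rightarrow> 'k"

definition nondegenerate_on :: "('k::field ^ 'n \<Rightarrow> 'k ^ 'n \<Rightarrow> 'k) \<Rightarrow> ('k ^ 'n) set \<Rightarrow> bool" where
  "nondegenerate_on \<beta> S \<longleftrightarrow> (\<forall>x\<in>S. (\<forall>y\<in>S. \<beta> x y = 0) \<longrightarrow> x = 0)"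

context alt_form
begin

text \<open>A vector orthogonal to a set is orthogonal to its span.\<close>
lemma orthogonal_span:
  assumes "\<And>b. b \<in> B \<Longrightarrow> \<beta> x b = 0" "y \<in> vec.span B"
  shows "\<beta> x y = 0"
proof -
  have "vec.subspace {y. \<beta> x y = 0}"
    unfolding vec.subspace_def by (auto simp: add_right scale_right)
  then show ?thesis using vec.span_minimal[of B "{y. \<beta> x y = 0}"] assms by auto
qed

text \<open>A hyperbolic pair \<open>\<beta> z\<^sub>1 z\<^sub>2 = 1\<close> spans a plane \<open>P\<close>; the map
  \<open>x \<mapsto> x + \<beta> x z\<^sub>1 z\<^sub>2 - \<beta> x z\<^sub>2 z\<^sub>1\<close> projects along \<open>P\<close> onto the orthogonal complement of \<open>P\<close>,
  and \<open>P\<close> meets that complement only in \<open>0\<close>.\<close>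
lemma hyperbolic_projection:
  assumes "\<beta> z1 z2 = 1"
  shows "\<beta> z1 (x + \<beta> x z1 *s z2 - \<beta> x z2 *s z1) = 0" "\<beta> z2 (x + \<beta> x z1 *s z2 - \<beta> x z2 *s z1) = 0"
    and "x - (x + \<beta> x z1 *s z2 - \<beta> x z2 *s z1) \<in> vec.span {z1, z2}"
proof -
  have "\<beta> z2 z1 = -1" using skew[of z2 z1] assms by simp
  then have "\<beta> z1 (x + \<beta> x z1 *s z2 - \<beta> x z2 *s z1) = \<beta> z1 x + \<beta> x z1"
    "\<beta> z2 (x + \<beta> x z1 *s z2 - \<beta> x z2 *s z1) = \<beta> z2 x + \<beta> x z2"
    unfolding diff_conv_add_uminus using assms
    by (simp_all add: add_right scale_right alternating flip: vec.scale_minus_left)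
  then show "\<beta> z1 (x + \<beta> x z1 *s z2 - \<beta> x z2 *s z1) = 0" "\<beta> z2 (x + \<beta> x z1 *s z2 - \<beta> x z2 *s z1) = 0"
    using skew[of z1 x] skew[of z2 x] by simp_all
  have "x - (x + \<beta> x z1 *s z2 - \<beta> x z2 *s z1) = \<beta> x z2 *s z1 - \<beta> x z1 *s z2"
    by (simp add: algebra_simps)
  then show "x - (x + \<beta> x z1 *s z2 - \<beta> x z2 *s z1) \<in> vec.span {z1, z2}"
    by (simp add: vec.span_diff vec.span_scale vec.span_base)
qed

lemma hyperbolic_plane_meet:
  assumes "\<beta> z1 z2 = 1" "p \<in> vec.span {z1, z2}" "\<beta> z1 p = 0" "\<beta> z2 p = 0"
  shows "p = 0"
proof -
  obtain a b where "p - a *s z1 = b *s z2"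
    using assms(2) unfolding vec.span_breakdown_eq vec.span_singleton by blast
  then have "p = a *s z1 + b *s z2" by (simp add: algebra_simps)
  then show ?thesis
    using assms skew[of z2 z1] by (simp add: add_right scale_right alternating)
qed

lemma hyperbolic_plane_dim:
  assumes "\<beta> z1 z2 = 1"
  shows "vec.dim (vec.span {z1, z2}) = 2"
proof -
  have z2_z1: "z2 \<notin> vec.span {z1}"
    using assms by (auto simp: vec.span_singleton scale_right alternating)
  moreover have "z1 \<noteq> 0" using assms skew[of z1 z2] by auto
  ultimately have "vec.independent (insert z2 {z1})" by (simp add: vec.independent_insert)
  moreover have "insert z2 {z1} = {z1, z2}" "z1 \<noteq> z2"
    using z2_z1 vec.span_base[of z1 "{z1}"] by auto
  ultimately show ?thesis by (simp add: vec.dim_eq_card_independent)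
qed

text \<open>Splitting off a hyperbolic plane: if \<open>\<beta>\<close> is nondegenerate on \<open>S\<close> and \<open>0 \<noteq> z\<^sub>1 \<in> S\<close>,
  there is \<open>z\<^sub>2 \<in> S\<close> with \<open>\<beta> z\<^sub>1 z\<^sub>2 = 1\<close>, and \<open>\<beta>\<close> stays nondegenerate on the orthogonal
  complement \<open>S'\<close> of \<open>{z\<^sub>1, z\<^sub>2}\<close> in \<open>S\<close>, which has codimension \<open>2\<close>.\<close>
lemma hyperbolic_splitting:
  assumes S: "vec.subspace S" "nondegenerate_on \<beta> S" and z1: "z1 \<in> S" "z1 \<noteq> 0"
  obtains z2 S' where "z2 \<in> S" "\<beta> z1 z2 = 1" "vec.subspace S'" "S' \<subseteq> S"
    "vec.dim S = vec.dim S' + 2" "nondegenerate_on \<beta> S'" "\<And>x. x \<in> S' \<Longrightarrow> \<beta> z1 x = 0"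
proof -
  obtain y where y: "y \<in> S" "\<beta> z1 y \<noteq> 0" using S(2) z1 unfolding nondegenerate_on_def by blast
  define z2 where "z2 = (1 / \<beta> z1 y) *s y"
  have z2: "z2 \<in> S" "\<beta> z1 z2 = 1"
    using y S(1) by (simp_all add: z2_def vec.subspace_scale scale_right)
  define S' where "S' = {x\<in>S. \<beta> z1 x = 0 \<and> \<beta> z2 x = 0}"
  define P where "P = vec.span {z1, z2}"
  let ?proj = "\<lambda>x. x + \<beta> x z1 *s z2 - \<beta> x z2 *s z1"
  have S': "vec.subspace S'" "S' \<subseteq> S"
    using S(1) unfolding S'_def vec.subspace_def by (auto simp: add_right scale_right)
  have decomp: "x - ?proj x \<in> P \<and> ?proj x \<in> S'" if x: "x \<in> S" for x
    using hyperbolic_projection[OF z2(2), of x] x z1 z2 S(1) unfolding S'_def P_def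
    by (auto intro!: vec.subspace_diff vec.subspace_add vec.subspace_scale)
  have "{x + y |x y. x \<in> P \<and> y \<in> S'} = S"
  proof safe
    fix x y assume "x \<in> P" "y \<in> S'"
    moreover have "P \<subseteq> S" unfolding P_def using z1 z2 S(1) by (intro vec.span_minimal) auto
    ultimately show "x + y \<in> S" using S' S(1) by (auto intro: vec.subspace_add)
  next
    fix x assume x: "x \<in> S"
    have "x = (x - ?proj x) + ?proj x" by simp
    then show "\<exists>p s. x = p + s \<and> p \<in> P \<and> s \<in> S'" using decomp[OF x] by blast
  qed
  moreover have "P \<inter> S' \<subseteq> {0}"
    using hyperbolic_plane_meet[OF z2(2)] unfolding P_def S'_def by blast
  ultimately have dim_S: "vec.dim S = vec.dim S' + 2"
    using dim_direct_sum[of P S'] S'(1) hyperbolic_plane_dim[OF z2(2)] unfolding P_def by simp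
  have nondeg: "nondegenerate_on \<beta> S'"
    unfolding nondegenerate_on_def
  proof (intro ballI impI)
    fix x assume x: "x \<in> S'" and orth: "\<forall>y\<in>S'. \<beta> x y = 0"
    have "\<beta> x z1 = 0" "\<beta> x z2 = 0" using x skew[of x z1] skew[of x z2] by (auto simp: S'_def)
    then have orth_P: "\<beta> x p = 0" if "p \<in> P" for p
      using that orthogonal_span[of "{z1, z2}" x p] unfolding P_def by blast
    have "\<beta> x y = 0" if y: "y \<in> S" for y
    proof -
      have "\<beta> x y = \<beta> x ((y - ?proj y) + ?proj y)" by simp
      also have "\<dots> = \<beta> x (y - ?proj y) + \<beta> x (?proj y)" by (rule add_right)
      finally show ?thesis using decomp[OF y] orth orth_P by simp
    qed
    then show "x = 0" using S(2) x S' unfolding nondegenerate_on_def by blast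
  qed
  show ?thesis by (rule that[of z2 S']) (use z2 S' dim_S nondeg in \<open>auto simp: S'_def\<close>)
qed

text \<open>A nondegenerate alternating form lives on an even-dimensional space and has a
  nonvanishing Pfaffian on some list of \<open>dim S\<close> vectors of \<open>S\<close> (a symplectic basis).\<close>
lemma nondegenerate_pfaffian:
  assumes "vec.subspace S" "nondegenerate_on \<beta> S"
  shows "even (vec.dim S) \<and> (\<exists>s. set s \<subseteq> S \<and> length s = vec.dim S \<and> pfaffian \<beta> s \<noteq> 0)"
  using assms
proof (induction "vec.dim S" arbitrary: S rule: less_induct)
  case less
  show ?case
  proof (cases "S \<subseteq> {0}")
    case True
    then have "vec.dim S = 0" by simp
    then show ?thesis by (auto intro!: exI[of _ "[]"] simp del: vec.dim_eq_0)
  next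
    case False
    then obtain z1 where z1: "z1 \<in> S" "z1 \<noteq> 0" by blast
    obtain z2 S' where z2: "z2 \<in> S" "\<beta> z1 z2 = 1"
      and S': "vec.subspace S'" "S' \<subseteq> S" "vec.dim S = vec.dim S' + 2" "nondegenerate_on \<beta> S'"
      and orth: "\<And>x. x \<in> S' \<Longrightarrow> \<beta> z1 x = 0"
      using hyperbolic_splitting[OF less.prems z1] by blast
    obtain s' where s': "set s' \<subseteq> S'" "length s' = vec.dim S'" "pfaffian \<beta> s' \<noteq> 0"
      and "even (vec.dim S')" using less.hyps[of S'] S' by auto
    moreover have "\<beta> z1 (s' ! i) = 0" if "i < length s'" for i
      using orth s'(1) that nth_mem by blast
    then have "pfaffian \<beta> (z1 # z2 # s') = pfaffian \<beta> s'"
      using z2(2) by (simp add: sum.lessThan_Suc_shift del: sum.lessThan_Suc)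
    ultimately show ?thesis
      using S' z1 z2 by (intro conjI exI[of _ "z1 # z2 # s'"]) auto
  qed
qed

end

subsection \<open>Radicals of alternating forms on a hyperplane\<close>

text \<open>Here \<open>H\<close> is a subspace (later a hyperplane with \<open>V = H \<oplus> K u\<close>) and \<open>v \<noteq> 0\<close> is a
  radical vector of \<open>\<beta>|\<^sub>H\<close>; the lemmas are applied to \<open>\<beta> = \<omega>(v, -, -)\<close>.\<close>

context alt_form
begin

text \<open>An alternating form on an odd-dimensional space is degenerate.\<close>
lemma odd_dim_degenerate:
  assumes "vec.subspace T" "odd (vec.dim T)"
  obtains h where "h \<in> T" "h \<noteq> 0" "\<forall>t\<in>T. \<beta> h t = 0"
  using nondegenerate_pfaffian[OF assms(1)] assms(2) unfolding nondegenerate_on_def by blast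

text \<open>On an even-dimensional space, the radical cannot be just the line \<open>K v\<close>: a complement
  of \<open>K v\<close> is odd-dimensional, so \<open>\<beta>\<close> is degenerate there.\<close>
lemma second_radical_vector:
  assumes H: "vec.subspace H" "even (vec.dim H)"
    and v: "v \<in> H" "v \<noteq> 0" "\<forall>y\<in>H. \<beta> v y = 0"
  obtains h where "h \<in> H" "h \<notin> vec.span {v}" "\<forall>y\<in>H. \<beta> h y = 0"
proof -
  obtain T where T: "vec.subspace T" "T \<subseteq> H" "vec.dim T + 1 = vec.dim H"
    "vec.span {v} \<inter> T \<subseteq> {0}" "\<And>y. y \<in> H \<Longrightarrow> \<exists>a\<in>vec.span {v}. y - a \<in> T"
    using complement_subspace[OF H(1), of "{v}" "{}"] v by auto
  obtain h where h: "h \<in> T" "h \<noteq> 0" "\<forall>t\<in>T. \<beta> h t = 0"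
    using odd_dim_degenerate[OF T(1)] T(3) H(2) by (metis even_add odd_one)
  have "\<beta> h y = 0" if y: "y \<in> H" for y
  proof -
    obtain c where c: "y - c *s v \<in> T"
      using T(5)[OF y] by (auto simp: vec.span_singleton)
    have "\<beta> h v = 0" using skew[of h v] v(3) h(1) T(2) by auto
    moreover have "\<beta> h y = \<beta> h (y - c *s v) + c * \<beta> h v"
      using add_right[of h "y - c *s v" "c *s v"] scale_right[of h c v] by simp
    ultimately show ?thesis using h(3) c by simp
  qed
  moreover have "h \<notin> vec.span {v}" using h T(4) by blast
  ultimately show ?thesis using that h(1) T(2) by blast
qed

text \<open>A vector orthogonal to \<open>H\<close> and to \<open>u\<close> is in the radical of \<open>\<beta>\<close>.\<close>
lemma radical_from_hyperplane:
  assumes dec: "\<And>z. \<exists>c. z - c *s u \<in> H" and x: "\<forall>y\<in>H. \<beta> x y = 0" "\<beta> x u = 0"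
  shows "\<beta> x z = 0"
proof -
  obtain c where c: "z - c *s u \<in> H" using dec by blast
  have "\<beta> x z = \<beta> x (z - c *s u) + c * \<beta> x u"
    using add_right[of x "z - c *s u" "c *s u"] scale_right[of x c u] by simp
  then show ?thesis using x c by simp
qed

text \<open>Assume from now on that the radical of \<open>\<beta>\<close> on \<open>V\<close> is \<open>K v\<close>. A radical vector \<open>h \<notin> K v\<close>
  of \<open>\<beta>|\<^sub>H\<close> then pairs nontrivially with \<open>u\<close>, and every radical vector \<open>s\<close> of \<open>\<beta>|\<^sub>H\<close> lies
  in \<open>span {v, h}\<close>, because \<open>s - k h\<close> is in the radical on \<open>V\<close> for a suitable \<open>k\<close>.\<close>
lemma radical_pairs_with_u:
  assumes dec: "\<And>z. \<exists>c. z - c *s u \<in> H"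
    and rad: "\<And>x. (\<forall>z. \<beta> x z = 0) \<Longrightarrow> x \<in> vec.span {v}"
    and h: "h \<notin> vec.span {v}" "\<forall>y\<in>H. \<beta> h y = 0"
  shows "\<beta> h u \<noteq> 0"
  using radical_from_hyperplane[OF dec h(2)] rad h(1) by blast

lemma radical_in_plane:
  assumes dec: "\<And>z. \<exists>c. z - c *s u \<in> H"
    and rad: "\<And>x. (\<forall>z. \<beta> x z = 0) \<Longrightarrow> x \<in> vec.span {v}"
    and h: "\<forall>y\<in>H. \<beta> h y = 0" "\<beta> h u \<noteq> 0" and s: "\<forall>y\<in>H. \<beta> s y = 0"
  shows "s \<in> vec.span {v, h}"
proof -
  define k where "k = \<beta> s u / \<beta> h u"
  have diff: "\<beta> (s - k *s h) y = \<beta> s y - k * \<beta> h y" for y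
    using add_left[of s "- (k *s h)" y] scale_left[of "- k" h y] by simp
  have "\<beta> (s - k *s h) z = 0" for z
  proof (rule radical_from_hyperplane[OF dec])
    show "\<forall>y\<in>H. \<beta> (s - k *s h) y = 0" using s h(1) by (simp add: diff)
    show "\<beta> (s - k *s h) u = 0" unfolding diff using h(2) by (simp add: k_def)
  qed
  then obtain c where "s - k *s h = c *s v" using rad by (auto simp: vec.span_singleton)
  then have "s = c *s v + k *s h" by (simp add: algebra_simps)
  then show ?thesis by (simp add: vec.span_add vec.span_scale vec.span_base)
qed

text \<open>Consequently \<open>\<beta>\<close> is nondegenerate on any complement \<open>S\<close> of \<open>span {v, h}\<close> in \<open>H\<close>: a
  vector of \<open>S\<close> orthogonal to \<open>S\<close> is orthogonal to all of \<open>H\<close>, so it lies in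
  \<open>span {v, h} \<inter> S = 0\<close>.\<close>
lemma nondegenerate_complement:
  assumes H: "vec.subspace H" and dec: "\<And>z. \<exists>c. z - c *s u \<in> H"
    and rad: "\<And>x. (\<forall>z. \<beta> x z = 0) \<Longrightarrow> x \<in> vec.span {v}"
    and v: "v \<in> H" "v \<noteq> 0" "\<forall>y\<in>H. \<beta> v y = 0"
    and h: "h \<in> H" "h \<notin> vec.span {v}" "\<forall>y\<in>H. \<beta> h y = 0"
  obtains S where "vec.subspace S" "S \<subseteq> H" "vec.dim S + 2 = vec.dim H" "nondegenerate_on \<beta> S"
proof -
  have "vec.independent (insert h {v})" using v(2) h(2) by (simp add: vec.independent_insert)
  moreover have vh: "insert h {v} = {v, h}" "v \<noteq> h" using h(2) vec.span_base[of v "{v}"] by auto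
  ultimately have indep: "vec.independent {v, h}" by simp
  obtain S where S: "vec.subspace S" "S \<subseteq> H" "vec.dim S + card {v, h} = vec.dim H"
    "vec.span {v, h} \<inter> S \<subseteq> {0}" "\<And>y. y \<in> H \<Longrightarrow> \<exists>a\<in>vec.span {v, h}. y - a \<in> S"
    using complement_subspace[OF H, of "{v, h}" "{}"] indep v(1) h(1) by auto
  have "nondegenerate_on \<beta> S"
    unfolding nondegenerate_on_def
  proof (intro ballI impI)
    fix s assume s: "s \<in> S" and orth: "\<forall>t\<in>S. \<beta> s t = 0"
    have "\<beta> s y = 0" if y: "y \<in> H" for y
    proof -
      obtain a where a: "a \<in> vec.span {v, h}" "y - a \<in> S" using S(5)[OF y] by blast
      have "\<beta> s v = 0" "\<beta> s h = 0" using skew[of s v] skew[of s h] v(3) h(3) s S(2) by auto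
      then have "\<beta> s a = 0" using orthogonal_span[of "{v, h}" s a] a(1) by blast
      moreover have "\<beta> s y = \<beta> s (y - a) + \<beta> s a"
        using add_right[of s "y - a" a] by simp
      ultimately show "\<beta> s y = 0" using orth a(2) by simp
    qed
    then have "s \<in> vec.span {v, h}"
      using radical_in_plane[OF dec rad h(3) radical_pairs_with_u[OF dec rad h(2,3)]] by blast
    then show "s = 0" using S(4) s by blast
  qed
  then show ?thesis using that S(1,2,3) vh(2) by simp
qed

end

subsection \<open>Pencils of alternating forms\<close>

text \<open>The pencil \<open>\<omega>(v, -, -) + t \<omega>(u, -, -)\<close>, an alternating form with values in \<open>K[t]\<close>.\<close>
definition pencil :: "('k::field ^ 'n \<Rightarrow> 'k ^ 'n \<Rightarrow> 'k ^ 'n \<Rightarrow> 'k) \<Rightarrow> 'k ^ 'n \<Rightarrow> 'k ^ 'n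
    \<Rightarrow> 'k ^ 'n \<Rightarrow> 'k ^ 'n \<Rightarrow> 'k poly" where
  "pencil w v u a b = [:w v a b, w u a b:]"

text \<open>Signs in \<open>K[t]\<close> are constant polynomials.\<close>
lemma neg_one_power_poly: "((-1)::'a::comm_ring_1 poly) ^ j = [:(-1) ^ j:]"
  by (induction j) (auto simp: algebra_simps)

text \<open>The \<open>t\<^sup>0\<close>- and \<open>t\<^sup>1\<close>-coefficients of a term of the Laplace expansion.\<close>
lemma coeff_pencil_term:
  "coeff ((-1) ^ j * pencil w v u a b * P) 0 = (-1) ^ j * (w v a b * coeff P 0)"
  "coeff ((-1) ^ j * pencil w v u a b * P) 1 = (-1) ^ j * (w v a b * coeff P 1 + w u a b * coeff P 0)"
  unfolding pencil_def neg_one_power_poly by (simp_all add: coeff_mult_0 coeff_mult algebra_simps)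

text \<open>The expansion of the Pfaffian of a pencil, coefficientwise.\<close>
lemma coeff_pfaffian_pencil_Cons:
  "coeff (pfaffian (pencil w v u) (y # ys)) 0 = (\<Sum>j<length ys.
     (-1)^j * (w v y (ys ! j) * coeff (pfaffian (pencil w v u) (remove_nth j ys)) 0))"
  "coeff (pfaffian (pencil w v u) (y # ys)) 1 = (\<Sum>j<length ys.
     (-1)^j * (w v y (ys ! j) * coeff (pfaffian (pencil w v u) (remove_nth j ys)) 1
       + w u y (ys ! j) * coeff (pfaffian (pencil w v u) (remove_nth j ys)) 0))"
  by (simp_all only: pfaffian.simps coeff_sum coeff_pencil_term)

text \<open>Setting \<open>t = 0\<close> commutes with taking Pfaffians.\<close>
lemma coeff_0_pfaffian: "coeff (pfaffian B zs) 0 = pfaffian (\<lambda>a b. coeff (B a b) 0) zs"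
proof (induction B zs rule: pfaffian.induct)
  case (2 B y ys)
  then show ?case
    unfolding pfaffian.simps coeff_sum
    by (intro sum.cong refl) (simp add: neg_one_power_poly coeff_mult_0)
qed simp

lemma coeff_0_pfaffian_pencil: "coeff (pfaffian (pencil w v u) zs) 0 = pfaffian (w v) zs"
  by (simp add: coeff_0_pfaffian pencil_def)

text \<open>From now on \<open>w\<close> is an alternating trilinear form \<open>\<omega>\<close>; its contractions \<open>\<omega>(a, -, -)\<close>
  and \<open>\<omega>(-, -, c)\<close> are alternating forms, and \<open>\<omega>\<close> is invariant under cyclic permutations.\<close>
context
  fixes w :: "'k::field ^ 'n \<Rightarrow> 'k ^ 'n \<Rightarrow> 'k ^ 'n \<Rightarrow> 'k"
  assumes w: "alternating_trilinear w"
begin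

lemma linear_1: "w (a + a') b c = w a b c + w a' b c" "w (t *s a) b c = t * w a b c"
  and linear_2: "w a (b + b') c = w a b c + w a b' c" "w a (t *s b) c = t * w a b c"
  and linear_3: "w a b (c + c') = w a b c + w a b c'" "w a b (t *s c) = t * w a b c"
  using w unfolding alternating_trilinear_def trilinear_def Vector_Spaces.linear_iff by auto

lemma alternating_w: "w a a c = 0" "w a b a = 0" "w b a a = 0"
  using w unfolding alternating_trilinear_def by auto

lemma alt_form_23: "alt_form (w a)"
  by unfold_locales (auto simp: linear_2 linear_3 alternating_w)

lemma alt_form_12: "alt_form (\<lambda>a b. w a b c)"
  by unfold_locales (auto simp: linear_1 linear_2 alternating_w)

lemma alt_bilinear_pencil: "alt_bilinear (pencil w v u) (\<lambda>t. [:t:])"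
  by unfold_locales (auto simp: pencil_def linear_2 linear_3 alternating_w)

lemma cyclic: "w u v h = w v h u"
  using alt_bilinear.skew[OF alt_form_12[unfolded alt_form_def], of u v h]
    alt_bilinear.skew[OF alt_form_23[unfolded alt_form_def], of v u h] by simp

lemma sum_left: "finite I \<Longrightarrow> w (\<Sum>i\<in>I. f i) b c = (\<Sum>i\<in>I. w (f i) b c)"
proof (induction I rule: finite_induct)
  case empty
  show ?case using linear_1(2)[of 0 0 b c] by simp
qed (simp add: linear_1)

text \<open>Write \<open>v = \<Sum> x\<^sub>i w\<^sub>i\<close> in terms of a list \<open>ws\<close> of \<open>m\<close> vectors. On a list of length \<open>2k\<close>, the
  Pfaffian of the pencil is \<open>P\<^sub>0 + P\<^sub>1 t + \<dots>\<close> where \<open>P\<^sub>0\<close> is a form of degree \<open>k\<close> and \<open>P\<^sub>1\<close>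
  a form of degree \<open>k - 1\<close> in \<open>x\<close> (every entry of the Gram matrix is linear in \<open>x\<close> or
  constant); for \<open>k = 0\<close> the coefficient \<open>P\<^sub>1\<close> vanishes.\<close>
lemma hom_poly_pencil_pfaffian:
  assumes "length zs = 2 * k"
  shows "hom_poly m k (\<lambda>x. coeff (pfaffian (pencil w (\<Sum>i<m. x i *s ws ! i) u) zs) 0) \<and>
    hom_poly m (k - 1) (\<lambda>x. coeff (pfaffian (pencil w (\<Sum>i<m. x i *s ws ! i) u) zs) 1) \<and>
    (k = 0 \<longrightarrow> (\<forall>x. coeff (pfaffian (pencil w (\<Sum>i<m. x i *s ws ! i) u) zs) 1 = 0))"
  using assms
proof (induction k arbitrary: zs)
  case 0
  then show ?case using hom_poly_const[of m 1] hom_poly_zero[of m 0] by simp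
next
  case (Suc k)
  let ?v = "\<lambda>x. \<Sum>i<m. x i *s ws ! i"
  let ?P = "\<lambda>x zs. pfaffian (pencil w (?v x) u) zs"
  obtain y ys where zs: "zs = y # ys" using Suc.prems by (cases zs) auto
  have IH: "hom_poly m k (\<lambda>x. coeff (?P x (remove_nth j ys)) 0) \<and>
    hom_poly m (k - 1) (\<lambda>x. coeff (?P x (remove_nth j ys)) 1) \<and>
    (k = 0 \<longrightarrow> (\<forall>x. coeff (?P x (remove_nth j ys)) 1 = 0))" if "j < length ys" for j
    using Suc.IH[of "remove_nth j ys"] that Suc.prems zs by simp
  have lin: "hom_poly m 1 (\<lambda>x. w (?v x) y z)" for z
  proof -
    have "(\<lambda>x. \<Sum>i<m. w (ws ! i) y z * x i) = (\<lambda>x. w (?v x) y z)"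
      by (simp add: sum_left linear_1 mult.commute)
    then show ?thesis using hom_poly_linear[of m "\<lambda>i. w (ws ! i) y z"] by simp
  qed
  have "hom_poly m (Suc k) (\<lambda>x. coeff (?P x zs) 0)"
    unfolding zs coeff_pfaffian_pencil_Cons
  proof (intro hom_poly_sum hom_poly_scale)
    fix j assume "j \<in> {..<length ys}"
    then show "hom_poly m (Suc k) (\<lambda>x. w (?v x) y (ys ! j) * coeff (?P x (remove_nth j ys)) 0)"
      using hom_poly_mult[OF lin] IH by fastforce
  qed simp
  moreover have "hom_poly m k (\<lambda>x. coeff (?P x zs) 1)"
    unfolding zs coeff_pfaffian_pencil_Cons
  proof (intro hom_poly_sum hom_poly_scale hom_poly_add)
    fix j assume j: "j \<in> {..<length ys}"
    show "hom_poly m k (\<lambda>x. w (?v x) y (ys ! j) * coeff (?P x (remove_nth j ys)) 1)"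
    proof (cases k)
      case 0
      then show ?thesis using IH j hom_poly_zero[of m k] by simp
    next
      case (Suc k')
      then show ?thesis using hom_poly_mult[OF lin] IH j by fastforce
    qed
    show "hom_poly m k (\<lambda>x. coeff (?P x (remove_nth j ys)) 0)"
      using IH j by blast
  qed simp
  ultimately show ?case by simp
qed

text \<open>The \<open>t\<close>-coefficient of the pencil's Pfaffian on a list \<open>v, h, s\<^sub>1, \<dots>\<close> when \<open>h\<close> is
  orthogonal for \<open>\<omega>(v, -, -)\<close> to the \<open>s\<^sub>i\<close>: only the term \<open>\<omega>(u, v, h) Pf(s)\<close> survives.\<close>
lemma pencil_pfaffian_coeff_1:
  assumes h: "\<And>s. s \<in> set sl \<Longrightarrow> w v h s = 0"
  shows "coeff (pfaffian (pencil w v u) (v # h # sl)) 1 = w u v h * pfaffian (w v) sl"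
proof -
  have h_first: "pfaffian (w v) (h # zs) = 0" if zs: "set zs \<subseteq> set sl" for zs
  proof -
    have "w v h (zs ! i) = 0" if "i < length zs" for i
      using h zs that nth_mem by blast
    then show ?thesis by simp
  qed
  have "coeff (pfaffian (pencil w v u) (v # h # sl)) 1
      = (\<Sum>j<Suc (length sl). (-1)^j * (w u v ((h # sl) ! j) * pfaffian (w v) (remove_nth j (h # sl))))"
    unfolding coeff_pfaffian_pencil_Cons by (simp add: alternating_w coeff_0_pfaffian_pencil)
  also have "\<dots> = w u v h * pfaffian (w v) sl"
  proof -
    have "pfaffian (w v) (remove_nth (Suc i) (h # sl)) = 0" for i
      using h_first[OF set_remove_nth] by (simp del: pfaffian.simps)
    then show ?thesis by (simp add: sum.lessThan_Suc_shift del: sum.lessThan_Suc pfaffian.simps)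
  qed
  finally show ?thesis .
qed

subsection \<open>The key lemma\<close>

text \<open>Let \<open>V = H \<oplus> K u\<close> with \<open>dim H = 2m\<close>, and let \<open>bs\<close> be a basis of \<open>H\<close>. If \<open>0 \<noteq> v \<in> H\<close>
  lies on no \<open>\<omega>\<close>-singular line, i.e.\ the radical of \<open>\<omega>(v, -, -)\<close> on \<open>V\<close> is \<open>K v\<close>, then the
  \<open>t\<close>-coefficient of the Pfaffian of the pencil on \<open>bs\<close> is nonzero. Indeed, \<open>\<omega>(v, -, -)|\<^sub>H\<close>
  has a second radical vector \<open>h\<close>; on a complement \<open>S\<close> of \<open>span {v, h}\<close> in \<open>H\<close> it is
  nondegenerate, with nonzero Pfaffian on some list \<open>sl\<close>; the coefficient is \<open>\<omega>(u, v, h) Pf(sl) \<noteq> 0\<close>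
  on the list \<open>v, h, sl\<close> spanning \<open>H\<close>, hence also nonzero on the basis \<open>bs\<close>.\<close>
lemma pencil_pfaffian_coeff_1_nonzero:
  assumes H: "vec.subspace H" "vec.dim H = 2 * m" and dec: "\<And>z. \<exists>c. z - c *s u \<in> H"
    and v: "v \<in> H" "v \<noteq> 0" and rad: "\<And>b. (\<forall>z. w v b z = 0) \<Longrightarrow> b \<in> vec.span {v}"
    and bs: "length bs = 2 * m" "distinct bs" "vec.span (set bs) = H"
  shows "coeff (pfaffian (pencil w v u) bs) 1 \<noteq> 0"
proof -
  interpret alt_form "w v" by (rule alt_form_23)
  have v_rad: "\<forall>y\<in>H. w v v y = 0" by (simp add: alternating_w)
  obtain h where h: "h \<in> H" "h \<notin> vec.span {v}" "\<forall>y\<in>H. w v h y = 0"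
    using second_radical_vector[OF H(1) _ v v_rad] H(2) by auto
  obtain S where S: "vec.subspace S" "S \<subseteq> H" "vec.dim S + 2 = vec.dim H" "nondegenerate_on (w v) S"
    using nondegenerate_complement[OF H(1) dec rad v v_rad h] by blast
  have hu: "w v h u \<noteq> 0" by (rule radical_pairs_with_u[OF dec rad h(2,3)])
  obtain sl where sl: "set sl \<subseteq> S" "length sl = vec.dim S" "pfaffian (w v) sl \<noteq> 0"
    using nondegenerate_pfaffian[OF S(1,4)] by blast
  let ?\<Phi> = "\<lambda>zs. coeff (pfaffian (pencil w v u) zs) 1"
  have "?\<Phi> (v # h # sl) = w u v h * pfaffian (w v) sl"
    using h(3) sl(1) S(2) by (intro pencil_pfaffian_coeff_1) auto
  moreover have "w u v h * pfaffian (w v) sl \<noteq> 0" using hu sl(3) cyclic[of u v h] by simp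
  ultimately have "?\<Phi> (v # h # sl) \<noteq> 0" by (simp only: not_False_eq_True)
  moreover have "alt_multilinear (2 * m) ?\<Phi>"
    by (rule alt_bilinear.alt_multilinear_pfaffian[OF alt_bilinear_pencil]) (auto simp: coeff_mult)
  ultimately show ?thesis
    using alt_multilinear.vanishes_on_span[of "2 * m" ?\<Phi> bs "v # h # sl"] bs v h sl S H by auto
qed

text \<open>A vector \<open>b \<notin> K v\<close> with \<open>\<omega>(v, b, -) = 0\<close> spans with \<open>v\<close> an \<open>\<omega>-singular\<close> line.\<close>
lemma singular_line:
  assumes v: "v \<noteq> 0" and b: "b \<notin> vec.span {v}" "\<forall>z. w v b z = 0"
  shows "omega_singular w (vec.span {v, b})"
proof -
  have "vec.independent (insert b {v})" using v b(1) by (simp add: vec.independent_insert)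
  moreover have "insert b {v} = {v, b}" "v \<noteq> b" using b(1) vec.span_base[of v "{v}"] by auto
  ultimately have "vec.dim (vec.span {v, b}) = 2" by (simp add: vec.dim_eq_card_independent)
  moreover have "w x y z = 0" if "x \<in> vec.span {v, b}" "y \<in> vec.span {v, b}" for x y z
  proof -
    interpret alt_form "\<lambda>x y. w x y z" by (rule alt_form_12)
    have "w y x' z = 0" if x': "x' \<in> {v, b}" for x'
    proof -
      have "w x' y' z = 0" if "y' \<in> {v, b}" for y'
        using x' that alternating_w b(2) skew[of b v] by auto
      then have "w x' y z = 0" using orthogonal_span[of "{v, b}" x' y] \<open>y \<in> vec.span {v, b}\<close> by blast
      then show ?thesis using skew[of y x'] by simp
    qed
    then have "w y x z = 0" using orthogonal_span[of "{v, b}" y x] \<open>x \<in> vec.span {v, b}\<close> by blast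
    then show ?thesis using skew[of x y] by simp
  qed
  ultimately show ?thesis unfolding omega_singular_def by simp
qed

end

subsection \<open>The theorem\<close>

text \<open>A subspace has a basis given as a list of distinct vectors.\<close>
lemma basis_list:
  fixes S :: "('k::field ^ 'n) set"
  assumes "vec.subspace S"
  obtains bs where "distinct bs" "vec.independent (set bs)" "vec.span (set bs) = S"
    "length bs = vec.dim S"
proof -
  obtain B where B: "B \<subseteq> S" "vec.independent B" "S \<subseteq> vec.span B" "card B = vec.dim S"
    using vec.basis_exists by blast
  obtain bs where "set bs = B" "distinct bs"
    using finite_distinct_list[OF vec.finiteI_independent[OF B(2)]] by blast
  then show ?thesis
    using that B vec.span_subspace[OF B(1) B(3) assms] distinct_card by metis
qed

text \<open>Coordinates with respect to a basis: a nontrivial combination is nonzero.\<close>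
lemma nontrivial_combination_nonzero:
  fixes ws :: "('k::field ^ 'n) list"
  assumes ws: "distinct ws" "vec.independent (set ws)" and i: "i < length ws" "x i \<noteq> 0"
  shows "(\<Sum>j<length ws. x j *s ws ! j) \<noteq> 0"
proof
  assume zero: "(\<Sum>j<length ws. x j *s ws ! j) = 0"
  let ?rest = "\<Sum>j\<in>{..<length ws} - {i}. x j *s ws ! j"
  have "x i *s ws ! i + ?rest = 0"
    using zero i by (simp add: sum.remove)
  then have eq: "x i *s ws ! i = - ?rest" by (simp add: eq_neg_iff_add_eq_0)
  have "ws ! i = (1 / x i) *s (x i *s ws ! i)" using i(2) by simp
  also have "\<dots> = (1 / x i) *s (- ?rest)" by (simp only: eq)
  finally have "ws ! i = (1 / x i) *s (- ?rest)" .
  moreover have "?rest \<in> vec.span (set ws - {ws ! i})"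
    using ws(1) i(1) by (intro vec.span_sum vec.span_scale vec.span_base) (auto simp: nth_eq_iff_index_eq)
  ultimately have "ws ! i \<in> vec.span (set ws - {ws ! i})"
    by (simp add: vec.span_neg vec.span_scale)
  moreover have "ws ! i \<in> set ws" using i(1) by simp
  ultimately show False using ws(2) vec.dependent_def by blast
qed

text \<open>A proper subspace \<open>W\<close> lies in a hyperplane \<open>H\<close> with \<open>V = H \<oplus> K u\<close>.\<close>
lemma hyperplane_complement:
  fixes W :: "('k::field ^ 'n) set"
  assumes W: "vec.subspace W" "W \<noteq> UNIV"
  obtains u H where "vec.subspace H" "W \<subseteq> H" "vec.dim H + 1 = vec.dim (UNIV :: ('k ^ 'n) set)"
    "\<And>z. \<exists>c. z - c *s u \<in> H"
proof -
  obtain ws where ws: "distinct ws" "vec.independent (set ws)" "vec.span (set ws) = W"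
    by (rule basis_list[OF W(1)])
  obtain u where u: "u \<notin> W" using W(2) by blast
  then have indep: "vec.independent ({u} \<union> set ws)"
    using vec.independent_insertI[of u "set ws"] ws(2,3) by simp
  have disj: "{u} \<inter> set ws = {}" using u ws(3) vec.span_base by auto
  obtain H where H: "vec.subspace H" "set ws \<subseteq> H" "H \<subseteq> UNIV"
    "vec.dim H + card {u} = vec.dim (UNIV :: ('k ^ 'n) set)" "vec.span {u} \<inter> H \<subseteq> {0}"
    and dec: "\<And>z. z \<in> UNIV \<Longrightarrow> \<exists>a\<in>vec.span {u}. z - a \<in> H"
    by (rule complement_subspace[OF vec.subspace_UNIV indep subset_UNIV disj]) blast
  have dec': "\<exists>c. z - c *s u \<in> H" for z using dec[of z] by (auto simp: vec.span_singleton)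
  have "W \<subseteq> H" using ws(3) H(1,2) vec.span_minimal by blast
  moreover have "vec.dim H + 1 = vec.dim (UNIV :: ('k ^ 'n) set)" using H(4) by simp
  ultimately show ?thesis using that[OF H(1)] dec' by blast
qed

text \<open>Chevalley--Warning on a subspace: a form of degree \<open>1 \<le> d < dim W\<close> in the coordinates
  with respect to a basis \<open>ws\<close> of \<open>W\<close> vanishes at some nonzero vector of \<open>W\<close>.\<close>
lemma form_on_subspace_has_zero:
  fixes ws :: "('k::{field,finite} ^ 'n) list"
  assumes ws: "distinct ws" "vec.independent (set ws)"
    and F: "hom_poly (length ws) d F" "1 \<le> d" "d < length ws"
  shows "\<exists>x. (\<Sum>i<length ws. x i *s ws ! i) \<in> vec.span (set ws)
    \<and> (\<Sum>i<length ws. x i *s ws ! i) \<noteq> 0 \<and> F x = 0"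
proof -
  obtain x where x: "\<exists>i<length ws. x i \<noteq> 0" "F x = 0"
    using chevalley_warning[OF F(1) F(3,2)] by blast
  have "(\<Sum>i<length ws. x i *s ws ! i) \<in> vec.span (set ws)"
    by (intro vec.span_sum vec.span_scale vec.span_base) simp
  moreover have "(\<Sum>i<length ws. x i *s ws ! i) \<noteq> 0"
    using x(1) nontrivial_combination_nonzero[OF ws] by auto
  ultimately show ?thesis using x(2) by blast
qed

theorem mainTheorem5:
  fixes w :: "'k::{field,finite} ^ 'n \<Rightarrow> 'k ^ 'n \<Rightarrow> 'k ^ 'n \<Rightarrow> 'k"
    and W :: "('k ^ 'n) set"
  assumes "odd CARD('n)" and "CARD('n) \<ge> 5"
    and "alternating_trilinear w"
    and "vec.subspace W" and "vec.dim W = (CARD('n) - 1) div 2"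
  shows "\<exists>v\<in>W. v \<noteq> 0 \<and> (\<exists>L. omega_singular w L \<and> v \<in> L)"
proof -
  define m where "m = (CARD('n) - 1) div 2"
  have n: "vec.dim (UNIV :: ('k ^ 'n) set) = 2 * m + 1" "m \<ge> 2"
    using assms(1,2) unfolding m_def by (simp_all add: card_cart_basis)
  obtain ws where ws: "distinct ws" "vec.independent (set ws)" "vec.span (set ws) = W" "length ws = m"
    using basis_list[OF assms(4)] assms(5) unfolding m_def by metis
  \<comment> \<open>split \<open>V = H \<oplus> K u\<close> with \<open>W \<subseteq> H\<close>, and fix a basis \<open>bs\<close> of \<open>H\<close>\<close>
  have "W \<noteq> UNIV" using n(1) assms(5) unfolding m_def by auto
  then obtain u H where H: "vec.subspace H" "W \<subseteq> H" "vec.dim H = 2 * m" and dec: "\<And>z. \<exists>c. z - c *s u \<in> H"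
    using hyperplane_complement[OF assms(4)] n(1) by (metis add_right_cancel)
  obtain bs where bs: "distinct bs" "vec.span (set bs) = H" "length bs = 2 * m"
    using basis_list[OF H(1)] H(3) by metis
  \<comment> \<open>the \<open>t\<close>-coefficient of the pencil's Pfaffian, a form of degree \<open>m - 1\<close> on \<open>W\<close>, has a zero \<open>v \<noteq> 0\<close>\<close>
  define F where "F x = coeff (pfaffian (pencil w (\<Sum>i<m. x i *s ws ! i) u) bs) 1" for x
  have F: "hom_poly (length ws) (length ws - 1) F"
    using hom_poly_pencil_pfaffian[OF assms(3), of bs m] bs(3) ws(4) unfolding F_def by auto
  have "\<exists>x. (\<Sum>i<length ws. x i *s ws ! i) \<in> vec.span (set ws)
      \<and> (\<Sum>i<length ws. x i *s ws ! i) \<noteq> 0 \<and> F x = 0"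
    by (rule form_on_subspace_has_zero[OF ws(1,2) F]) (use ws(4) n(2) in auto)
  then obtain x where v: "(\<Sum>i<m. x i *s ws ! i) \<in> W" "(\<Sum>i<m. x i *s ws ! i) \<noteq> 0" "F x = 0"
    using ws(3,4) by auto
  define v where "v = (\<Sum>i<m. x i *s ws ! i)"
  \<comment> \<open>by the key lemma, \<open>F x = 0\<close> forces \<open>v\<close> onto a singular line\<close>
  have "\<exists>b. b \<notin> vec.span {v} \<and> (\<forall>z. w v b z = 0)"
  proof (rule ccontr)
    assume "\<nexists>b. b \<notin> vec.span {v} \<and> (\<forall>z. w v b z = 0)"
    then have "coeff (pfaffian (pencil w v u) bs) 1 \<noteq> 0"
      using v H(2) bs unfolding v_def by (intro pencil_pfaffian_coeff_1_nonzero[OF assms(3) H(1,3) dec]) auto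
    then show False using v(3) by (simp add: F_def v_def)
  qed
  then obtain b where "b \<notin> vec.span {v}" "\<forall>z. w v b z = 0" by blast
  then have "omega_singular w (vec.span {v, b})" using singular_line[OF assms(3)] v(2) v_def by blast
  then show ?thesis using v(1,2) vec.span_base[of v "{v, b}"] unfolding v_def by blast
qed

end
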